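(* For finite posets $P$ with $N\ge2$ elements and height $h\ge1$, $$O(\log h\cdot N^2)=o(N^3)\qquad (N\to\infty);$$ that is, the cost bound $O(\log h\cdot N^2)$ of Newton's iteration for computing the Möbius function in the incidence algebra $\mathrm{Inc}(P)$ is of strictly smaller order than the cost bound $O(N^3)$ of Gaussian inversion.
   Context: The height of $P$ is $h=\max\{k:\exists\,x_0<x_1<\cdots<x_k\text{ in }P\}$. The incidence algebra $\mathrm{Inc}(P)$ consists of functions on pairs $x\le y$ with convolution product $(f*g)(x,y)=\sum_{x\le z\le y}f(x,z)g(z,y)$; the Möbius function is the inverse of $\zeta\equiv1$. The paper assigns Newton's iteration the cost $O(\log h\cdot N^2)$ (counting $O(N^2)$ per convolution) and Gaussian inversion of triangular $N\times N$ matrices the cost $O(N^3)$. *)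

theory Defs
  imports Complex_Main "HOL-Library.Landau_Symbols"
begin

text \<open>
  A finite poset is a pair \<open>(A, r)\<close> of a finite carrier and a partial order on it, where
  \<open>(x, y) \<in> r\<close> means \<open>x \<le> y\<close>. Every finite poset occurs up to isomorphism
  over each infinite type.
\<close>

type_synonym 'a poset = "'a set \<times> 'a rel"

definition finite_poset :: "'a poset \<Rightarrow> bool"
  where "finite_poset P \<longleftrightarrow> finite (fst P) \<and> partial_order_on (fst P) (snd P)"

definition poset_size :: "'a poset \<Rightarrow> nat"
  where "poset_size P = card (fst P)"

definition strict_chain :: "'a poset \<Rightarrow> nat \<Rightarrow> (nat \<Rightarrow> 'a) \<Rightarrow> bool"
  where "strict_chain P k x \<longleftrightarrow>
    (\<forall>i\<le>k. x i \<in> fst P) \<and> (\<forall>i<k. (x i, x (Suc i)) \<in> snd P \<and> x i \<noteq> x (Suc i))"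

text \<open>A chain \<open>x\<^sub>0 < \<dots> < x\<^sub>k\<close> counts as \<open>k\<close>, so an antichain has height 0.\<close>

definition poset_height :: "'a poset \<Rightarrow> nat"
  where "poset_height P = Max {k. \<exists>x. strict_chain P k x}"

text \<open>
  The limit \<open>N \<rightarrow> \<infinity>\<close>, taken over all finite posets with \<open>N \<ge> 2\<close> and \<open>h \<ge> 1\<close>
  simultaneously: asymptotic statements along this filter are uniform in the poset, with no
  relation between \<open>h\<close> and \<open>N\<close> imposed.
\<close>

definition finite_posets_at_top :: "'a poset filter"
  where "finite_posets_at_top =
    inf (filtercomap poset_size at_top)
        (principal {P. finite_poset P \<and> poset_size P \<ge> 2 \<and> poset_height P \<ge> 1})"

lemma eventually_finite_posets_at_top:
  "eventually Q finite_posets_at_top \<longleftrightarrow>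
    (\<exists>N\<^sub>0. \<forall>P. finite_poset P \<and> poset_size P \<ge> 2 \<and> poset_height P \<ge> 1 \<and> poset_size P \<ge> N\<^sub>0
       \<longrightarrow> Q P)"
  unfolding finite_posets_at_top_def eventually_inf_principal eventually_filtercomap_at_top_linorder
  by auto

text \<open>Over an infinite type, asymptotic statements along this filter are not vacuous.\<close>

lemma finite_posets_at_top_neq_bot:
  assumes "infinite (UNIV :: 'a set)"
  shows "(finite_posets_at_top :: 'a poset filter) \<noteq> bot"
proof -
  have "\<exists>P :: 'a poset. finite_poset P \<and> poset_size P \<ge> 2 \<and> poset_height P \<ge> 1 \<and> poset_size P \<ge> n"
    for n
  proof -
    obtain A :: "'a set" where A: "finite A" "card A = n + 2"
      using infinite_arbitrarily_large[OF assms] by blast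
    then obtain B where "B \<subseteq> A" "card B = 2"
      by (metis le_add2 obtain_subset_with_card_n)
    then obtain a b where ab: "a \<in> A" "b \<in> A" "a \<noteq> b"
      by (auto simp: card_2_iff)
    define P where "P = (A, insert (a, b) (Id_on A))"
    have fin: "finite_poset P"
      using A ab by (auto simp: finite_poset_def P_def partial_order_on_def preorder_on_def
          refl_on_def trans_def antisym_def)
    have "k < 2" if x: "strict_chain P k x" for k x
    proof (rule ccontr)
      assume "\<not> k < 2"
      hence "(x 0, x 1) \<in> snd P \<and> x 0 \<noteq> x 1" "(x 1, x 2) \<in> snd P \<and> x 1 \<noteq> x 2"
        using x unfolding strict_chain_def
        by (auto simp: numeral_2_eq_2 dest: spec[of _ 0] spec[of _ "Suc 0"])
      thus False using ab by (auto simp: P_def)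
    qed
    hence "{k. \<exists>x. strict_chain P k x} \<subseteq> {..<2}" by auto
    hence finite: "finite {k. \<exists>x. strict_chain P k x}" by (rule finite_subset) simp
    have "strict_chain P 1 (\<lambda>i. if i = 0 then a else b)"
      using ab by (auto simp: strict_chain_def P_def)
    hence "poset_height P \<ge> 1"
      unfolding poset_height_def using finite by (intro Max_ge) auto
    moreover have "poset_size P = n + 2" using A by (simp add: P_def poset_size_def)
    ultimately show ?thesis using fin by (intro exI[of _ P]) simp
  qed
  thus ?thesis
    unfolding trivial_limit_def eventually_finite_posets_at_top by blast
qed

text \<open>
  The cost model. In Newton's iteration for the inverse of \<open>\<zeta>\<close> in the incidence algebra, each
  convolution is charged \<open>N\<^sup>2\<close> and the number of steps is charged \<open>log h\<close>; the base of the
  logarithm does not affect the class \<open>O(log h \<cdot> N\<^sup>2)\<close>. Inverting the triangular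
  \<open>N \<times> N\<close> matrix of \<open>\<zeta>\<close> by Gaussian elimination is charged \<open>N\<^sup>3\<close>.
\<close>

definition newton_cost_bound :: "'a poset \<Rightarrow> real"
  where "newton_cost_bound P = ln (real (poset_height P)) * real (poset_size P) ^ 2"

definition gauss_cost_bound :: "'a poset \<Rightarrow> real"
  where "gauss_cost_bound P = real (poset_size P) ^ 3"

end

theory Submission
  imports Defs
begin

text \<open>
  A strict chain \<open>x\<^sub>0 < \<dots> < x\<^sub>h\<close> consists of \<open>h + 1\<close> distinct elements, so \<open>h < N\<close> in every
  nonempty finite poset (\<open>poset_height_less_size\<close>). Together with \<open>h \<ge> 1\<close>, which makes the
  logarithm nonnegative, this gives \<open>0 \<le> log h \<cdot> N\<^sup>2 \<le> log N \<cdot> N\<^sup>2\<close>. The right-hand side depends on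
  the poset only through \<open>N\<close>, and \<open>log N = o(N)\<close>, so it is \<open>o(N\<^sup>3)\<close> uniformly in the poset.
\<close>

lemma strict_chain_less:
  assumes "finite_poset P" "strict_chain P k x" "i < j" "j \<le> k"
  shows "(x i, x j) \<in> snd P \<and> x i \<noteq> x j"
  using assms(3,4)
proof (induction j)
  case (Suc j)
  have tr: "trans (snd P)" and anti: "antisym (snd P)"
    using assms(1) by (auto simp: finite_poset_def partial_order_on_def preorder_on_def)
  have step: "(x j, x (Suc j)) \<in> snd P" "x j \<noteq> x (Suc j)"
    using assms(2) Suc.prems by (auto simp: strict_chain_def)
  show ?case
  proof (cases "i = j")
    case False
    hence "(x i, x j) \<in> snd P" using Suc by simp
    thus ?thesis using step transD[OF tr] antisymD[OF anti] by metis
  qed (use step in simp)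
qed simp

lemma strict_chain_length_less_size:
  assumes "finite_poset P" "strict_chain P k x"
  shows "k < poset_size P"
proof -
  have "inj_on x {..k}"
    by (rule linorder_inj_onI) (use strict_chain_less[OF assms] in auto)
  moreover have "x ` {..k} \<subseteq> fst P" using assms(2) by (auto simp: strict_chain_def)
  moreover have "finite (fst P)" using assms(1) by (simp add: finite_poset_def)
  ultimately have "card {..k} \<le> card (fst P)" by (rule card_inj_on_le)
  thus ?thesis by (simp add: poset_size_def)
qed

text \<open>
  The maximum defining the height is a genuine one: chain lengths are bounded by the size, and
  nonemptiness of the poset provides a chain of length 0.
\<close>

lemma poset_height_less_size:
  assumes "finite_poset P" "poset_size P > 0"
  shows "poset_height P < poset_size P"
proof -
  let ?K = "{k. \<exists>x. strict_chain P k x}"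
  have bound: "k < poset_size P" if "k \<in> ?K" for k
    using that strict_chain_length_less_size[OF assms(1)] by blast
  have "finite ?K" by (rule finite_subset[of _ "{..<poset_size P}"]) (use bound in auto)
  moreover obtain a where "a \<in> fst P"
    using assms(2) by (metis poset_size_def card.empty equals0I less_irrefl)
  hence "strict_chain P 0 (\<lambda>_. a)" by (simp add: strict_chain_def)
  hence "?K \<noteq> {}" by blast
  ultimately have "Max ?K \<in> ?K" by (rule Max_in)
  thus ?thesis unfolding poset_height_def by (rule bound)
qed

lemma filterlim_poset_size: "filterlim poset_size at_top finite_posets_at_top"
  unfolding finite_posets_at_top_def
  by (rule filterlim_mono[OF filterlim_filtercomap order_refl inf_le1])

lemma newton_cost_bound_bigo_size:
  "newton_cost_bound \<in> O[finite_posets_at_top](\<lambda>P. ln (real (poset_size P)) * real (poset_size P) ^ 2)"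
proof (rule landau_o.big_mono)
  have "norm (newton_cost_bound P) \<le> norm (ln (real (poset_size P)) * real (poset_size P) ^ 2)"
    if "finite_poset P" "poset_size P \<ge> 2" "poset_height P \<ge> 1" for P :: "'a poset"
  proof -
    have "poset_height P < poset_size P" using that by (intro poset_height_less_size) auto
    thus ?thesis using that by (auto simp: newton_cost_bound_def abs_mult intro!: mult_right_mono)
  qed
  thus "\<forall>\<^sub>F P :: 'a poset in finite_posets_at_top. norm (newton_cost_bound P)
          \<le> norm (ln (real (poset_size P)) * real (poset_size P) ^ 2)"
    unfolding eventually_finite_posets_at_top by blast
qed

lemma ln_mult_square_smallo_cube: "(\<lambda>n::nat. ln (real n) * real n ^ 2) \<in> o(\<lambda>n. real n ^ 3)"
proof -
  have "(\<lambda>n. ln (real n)) \<in> o(\<lambda>n. real n)"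
    using filterlim_compose[OF ln_x_over_x_tendsto_0 filterlim_real_sequentially]
    by (auto intro!: smalloI_tendsto eventually_sequentiallyI[of 1])
  hence "(\<lambda>n. ln (real n) * real n ^ 2) \<in> o(\<lambda>n. real n * real n ^ 2)"
    by (rule landau_o.small_big_mult) simp
  thus ?thesis by (simp add: power3_eq_cube power2_eq_square mult.assoc)
qed

theorem theoremM4:
  shows "O[finite_posets_at_top :: 'a poset filter](newton_cost_bound)
           \<subseteq> o[finite_posets_at_top](gauss_cost_bound)"
proof
  fix f :: "'a poset \<Rightarrow> real"
  assume "f \<in> O[finite_posets_at_top](newton_cost_bound)"
  also note newton_cost_bound_bigo_size
  also have "(\<lambda>P :: 'a poset. ln (real (poset_size P)) * real (poset_size P) ^ 2)
               \<in> o[finite_posets_at_top](gauss_cost_bound)"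
    unfolding gauss_cost_bound_def
    by (rule landau_o.small.compose[OF ln_mult_square_smallo_cube filterlim_poset_size])
  finally show "f \<in> o[finite_posets_at_top](gauss_cost_bound)" .
qed

end
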